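(* Let $N\ge2$, $p_e\in(0,1)$, and consider the XOR node of the context with i.i.d. Bernoulli$(p_e)$ inputs and binary oracle weights $\mathbf w^{\mathrm{true}}\in\{0,1\}^N$. Let the model weights $w_1,\dots,w_N$ be i.i.d. real random variables, independent of the inputs, with finite second moment and $\mathbb E[w_i]=1/2$. For each $j$ let $G_j(p_e)=\mathbb E\big[\partial\hat\ell_\oplus(\mathbf w)/\partial w_j\big]$, the expectation being over inputs and weights. Then: (i) the expected gradient has the correct sign to move weights contained in $(0,1)$ towards their oracle values under a gradient-descent update: $G_j(p_e)<0$ if $w_j^{\mathrm{true}}=1$ and $G_j(p_e)>0$ if $w_j^{\mathrm{true}}=0$; (ii) the sparsity $p_e=1/N$ maximizes the magnitude $|G_j(p_e)|$ of the expected gradient; (iii) this value coincides with the value of $p_e$ that maximizes the probability that an input vector of size $N$ has exactly one entry equal to $1$.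
   Context: The XOR node with weights $\mathbf w\in\mathbb R^N$ maps $\mathbf b\in\{0,1\}^N$ to $f(\mathbf w;\mathbf b)=\frac12\Big(1-\prod_{i=1}^N(1-2w_ib_i)\Big)$. For input vectors $\mathbf b_1,\dots,\mathbf b_M$ whose entries are i.i.d. Bernoulli$(p_e)$, the empirical risk is $\hat\ell_\oplus(\mathbf w)=\frac1M\sum_{m=1}^M\big(f(\mathbf w;\mathbf b_m)-f(\mathbf w^{\mathrm{true}};\mathbf b_m)\big)^2$. A gradient-descent update is $\mathbf w\mapsto\mathbf w-\alpha\nabla_{\mathbf w}\hat\ell_\oplus(\mathbf w)$ with $\alpha>0$. *)

theory Defs
  imports "HOL-Probability.Probability"
begin

definition xor_node :: "nat \<Rightarrow> (nat \<Rightarrow> real) \<Rightarrow> (nat \<Rightarrow> bool) \<Rightarrow> real" where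
  "xor_node N w b = (1 - (\<Prod>i<N. 1 - 2 * w i * of_bool (b i))) / 2"

definition empirical_risk ::
    "nat \<Rightarrow> nat \<Rightarrow> (nat \<Rightarrow> real) \<Rightarrow> (nat \<Rightarrow> nat \<Rightarrow> bool) \<Rightarrow> (nat \<Rightarrow> real) \<Rightarrow> real" where
  "empirical_risk N M wtrue bs w =
     (\<Sum>m<M. (xor_node N w (bs m) - xor_node N wtrue (bs m))\<^sup>2) / real M"

definition partial_deriv :: "nat \<Rightarrow> ((nat \<Rightarrow> real) \<Rightarrow> real) \<Rightarrow> (nat \<Rightarrow> real) \<Rightarrow> real" where
  "partial_deriv j L w = deriv (\<lambda>x. L (w(j := x))) (w j)"

text \<open>
  \<open>b m i\<close> is the \<open>i\<close>-th entry of the \<open>m\<close>-th input vector and \<open>w i\<close> the \<open>i\<close>-th model weight;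
  \<open>D\<close> is the common law of the weights. The weights and the inputs have different value
  types, so independence of the two families is stated for the sigma-algebras they generate;
  \<open>indep_var\<close> only relates variables of the same type.
\<close>

locale xor_training = prob_space \<Omega>
  for \<Omega> :: "'a measure" +
  fixes N M :: nat
    and p :: real
    and D :: "real measure"
    and w :: "nat \<Rightarrow> 'a \<Rightarrow> real"
    and b :: "nat \<Rightarrow> nat \<Rightarrow> 'a \<Rightarrow> bool"
  assumes inputs_indep:
      "indep_vars (\<lambda>_. count_space UNIV) (\<lambda>(m, i). b m i) ({..<M} \<times> {..<N})"
    and inputs_bernoulli:
      "\<And>m i. m < M \<Longrightarrow> i < N \<Longrightarrow>
         distr \<Omega> (count_space UNIV) (b m i) = measure_pmf (bernoulli_pmf p)"
    and weights_indep:
      "indep_vars (\<lambda>_. borel) w {..<N}"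
    and weights_law:
      "\<And>i. i < N \<Longrightarrow> distr \<Omega> borel (w i) = D"
    and weights_second_moment:
      "\<And>i. i < N \<Longrightarrow> integrable \<Omega> (\<lambda>\<omega>. (w i \<omega>)\<^sup>2)"
    and weights_mean:
      "\<And>i. i < N \<Longrightarrow> expectation (w i) = 1 / 2"
    and weights_indep_inputs:
      "indep_set
         {(\<lambda>\<omega>. \<lambda>i\<in>{..<N}. w i \<omega>) -` A \<inter> space \<Omega> | A.
            A \<in> sets (PiM {..<N} (\<lambda>_. borel))}
         {(\<lambda>\<omega>. \<lambda>(m, i)\<in>{..<M} \<times> {..<N}. b m i \<omega>) -` B \<inter> space \<Omega> | B.
            B \<in> sets (PiM ({..<M} \<times> {..<N}) (\<lambda>_. count_space UNIV))}"

definition expected_gradient ::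
    "'a measure \<Rightarrow> nat \<Rightarrow> nat \<Rightarrow> (nat \<Rightarrow> real) \<Rightarrow> (nat \<Rightarrow> 'a \<Rightarrow> real) \<Rightarrow>
     (nat \<Rightarrow> nat \<Rightarrow> 'a \<Rightarrow> bool) \<Rightarrow> nat \<Rightarrow> real" where
  "expected_gradient \<Omega> N M wtrue w b j =
     (\<integral>\<omega>. partial_deriv j (empirical_risk N M wtrue (\<lambda>m i. b m i \<omega>)) (\<lambda>i. w i \<omega>) \<partial>\<Omega>)"

definition exactly_one_prob ::
    "'a measure \<Rightarrow> nat \<Rightarrow> (nat \<Rightarrow> 'a \<Rightarrow> bool) \<Rightarrow> real" where
  "exactly_one_prob \<Omega> N v = measure \<Omega> {\<omega> \<in> space \<Omega>. card {i. i < N \<and> v i \<omega>} = 1}"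

end

theory Submission
  imports Defs
begin

text \<open>
  Only the set \<open>S\<close> of active entries of an input matters: for a single input the derivative of the
  squared error in \<open>w j\<close> is \<open>(\<Prod>i\<in>S. 1 - 2 * wtrue i) * Q - (1 - 2 * w j) * Q\<^sup>2\<close> with
  \<open>Q = (\<Prod>i\<in>S - {j}. 1 - 2 * w i)\<close> if \<open>j \<in> S\<close>, and zero otherwise. As \<open>1 - 2 * w i\<close> has
  mean zero, averaging over the weights kills everything except the first term for \<open>S = {j}\<close>, so
  \<open>G j p = (1 - 2 * wtrue j) * p * (1 - p) ^ (N - 1)\<close>. Up to constant factors, \<open>\<bar>G j p\<bar>\<close> is the
  probability of exactly one active entry; its maximiser is found from \<open>ln x \<le> x - 1\<close>.
\<close>

section \<open>Active entries and the derivative of the empirical risk\<close>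

definition active :: "nat \<Rightarrow> (nat \<Rightarrow> bool) \<Rightarrow> nat set" where
  "active N v = {i. i < N \<and> v i}"

text \<open>The active set is an explicit argument, so that it can be held fixed while the weights
  are averaged. The square stands inside the product, so that both terms are products of functions
  of distinct weights.\<close>

definition risk_slope :: "(nat \<Rightarrow> real) \<Rightarrow> nat \<Rightarrow> nat set \<Rightarrow> (nat \<Rightarrow> real) \<Rightarrow> real" where
  "risk_slope wtrue j S u =
     (if j \<in> S
      then (\<Prod>i\<in>S. 1 - 2 * wtrue i) * (\<Prod>i\<in>S - {j}. 1 - 2 * u i)
           - (1 - 2 * u j) * (\<Prod>i\<in>S - {j}. (1 - 2 * u i)\<^sup>2)
      else 0)"

lemma finite_active [simp]: "finite (active N v)"
  by (simp add: active_def)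

lemma active_subset: "active N v \<subseteq> {..<N}"
  by (auto simp: active_def)

lemma xor_node_active: "xor_node N w v = (1 - (\<Prod>i\<in>active N v. 1 - 2 * w i)) / 2"
proof -
  have "(\<Prod>i<N. 1 - 2 * w i * of_bool (v i)) = (\<Prod>i\<in>active N v. 1 - 2 * w i)"
    by (rule prod.mono_neutral_cong_right) (auto simp: active_def)
  then show ?thesis by (simp add: xor_node_def)
qed

text \<open>The product form lets independence of the entries factor the expectation of this
  indicator. An element of \<open>S\<close> beyond \<open>N\<close> would be invisible on the
  right-hand side, hence the assumption.\<close>

lemma of_bool_active_eq:
  assumes "S \<subseteq> {..<N}"
  shows "(of_bool (active N v = S) :: real) = (\<Prod>i<N. of_bool (v i \<longleftrightarrow> i \<in> S))"
proof (cases "active N v = S")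
  case True
  then show ?thesis by (auto simp: active_def intro!: prod.neutral[symmetric])
next
  case False
  then have "\<exists>i<N. \<not> (v i \<longleftrightarrow> i \<in> S)"
    using assms by (auto simp: active_def)
  with False show ?thesis by (auto intro!: prod_zero[symmetric])
qed

text \<open>As a function of weight \<open>j\<close> alone the node is affine: its product is
  \<open>(1 - 2 * x) * Q\<close> with \<open>Q\<close> free of \<open>x\<close> if \<open>j\<close>
  is active, and constant otherwise.\<close>

lemma DERIV_squared_error:
  "((\<lambda>x. (xor_node N (u(j := x)) v - xor_node N wtrue v)\<^sup>2)
     has_real_derivative risk_slope wtrue j (active N v) u) (at (u j))"
proof (cases "j \<in> active N v")
  case False
  then have "(\<Prod>i\<in>active N v. 1 - 2 * (u(j := x)) i) = (\<Prod>i\<in>active N v. 1 - 2 * u i)" for x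
    by (intro prod.cong) auto
  with False show ?thesis by (simp add: xor_node_active risk_slope_def)
next
  case True
  define Q where "Q = (\<Prod>i\<in>active N v - {j}. 1 - 2 * u i)"
  define T where "T = (\<Prod>i\<in>active N v. 1 - 2 * wtrue i)"
  have P: "(\<Prod>i\<in>active N v. 1 - 2 * (u(j := x)) i) = (1 - 2 * x) * Q" for x
    unfolding Q_def using True
    by (subst prod.remove[of _ j]) (auto intro!: prod.cong)
  have "((\<lambda>x. ((1 - (1 - 2 * x) * Q) / 2 - (1 - T) / 2)\<^sup>2)
          has_real_derivative T * Q - (1 - 2 * u j) * Q\<^sup>2) (at (u j))"
    by (auto intro!: derivative_eq_intros simp: field_simps power2_eq_square)
  then show ?thesis
    using True by (simp only: xor_node_active P T_def Q_def risk_slope_def if_True prod_power_distrib)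
qed

lemma partial_deriv_empirical_risk:
  "partial_deriv j (empirical_risk N M wtrue bs) u =
     (\<Sum>m<M. risk_slope wtrue j (active N (bs m)) u) / real M"
  unfolding partial_deriv_def empirical_risk_def
  by (intro DERIV_imp_deriv DERIV_cdivide DERIV_sum DERIV_squared_error)

section \<open>Independence of weights and inputs, and the law of the active set\<close>

context xor_training
begin

text \<open>Real-valued functions of the weights and of the inputs share a type, so
  \<open>indep_var\<close> and its product rule for expectations become available. The events they
  generate are among those of the two families, and independence passes to subfamilies.\<close>

lemma indep_var_weights_inputs:
  assumes g: "g \<in> borel_measurable (PiM {..<N} (\<lambda>_. borel))"
    and h: "h \<in> borel_measurable (PiM ({..<M} \<times> {..<N}) (\<lambda>_. count_space UNIV))"
  shows "indep_var borel (\<lambda>\<omega>. g (\<lambda>i\<in>{..<N}. w i \<omega>))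
                   borel (\<lambda>\<omega>. h (\<lambda>(m, i)\<in>{..<M} \<times> {..<N}. b m i \<omega>))"
proof -
  let ?W = "\<lambda>\<omega>. \<lambda>i\<in>{..<N}. w i \<omega>"
  let ?B = "\<lambda>\<omega>. \<lambda>(m, i)\<in>{..<M} \<times> {..<N}. b m i \<omega>"
  have W: "?W \<in> measurable \<Omega> (PiM {..<N} (\<lambda>_. borel))"
    using weights_indep by (intro measurable_restrict) (auto simp: indep_vars_def)
  have "(\<lambda>(m, i). b m i \<omega>) = (\<lambda>x. (case x of (m, i) \<Rightarrow> b m i) \<omega>)" for \<omega>
    by auto
  with inputs_indep have B: "?B \<in> measurable \<Omega> (PiM ({..<M} \<times> {..<N}) (\<lambda>_. count_space UNIV))"
    by (auto intro!: measurable_restrict simp: indep_vars_def)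
  \<comment> \<open>The witness is the preimage of \<open>A\<close> under \<open>g\<close>, cut down
    to the product space, in which the weight vector always lies.\<close>
  have gW: "\<exists>A'. (\<lambda>\<omega>. g (?W \<omega>)) -` A \<inter> space \<Omega> = ?W -` A' \<inter> space \<Omega> \<and>
              A' \<in> sets (PiM {..<N} (\<lambda>_. borel))" if "A \<in> sets borel" for A
    using measurable_sets[OF g that] measurable_space[OF W] by (intro exI conjI) auto
  have hB: "\<exists>A'. (\<lambda>\<omega>. h (?B \<omega>)) -` A \<inter> space \<Omega> = ?B -` A' \<inter> space \<Omega> \<and>
              A' \<in> sets (PiM ({..<M} \<times> {..<N}) (\<lambda>_. count_space UNIV))" if "A \<in> sets borel" for A
    using measurable_sets[OF h that] measurable_space[OF B] by (intro exI conjI) auto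
  have ind: "indep_sets (case_bool
          {(\<lambda>\<omega>. g (?W \<omega>)) -` A \<inter> space \<Omega> | A. A \<in> sets borel}
          {(\<lambda>\<omega>. h (?B \<omega>)) -` A \<inter> space \<Omega> | A. A \<in> sets borel}) UNIV"
    using weights_indep_inputs unfolding indep_set_def
    by (rule indep_sets_mono_sets) (split bool.split, split bool.split, use gW hB in blast)
  have rv: "(\<lambda>\<omega>. g (?W \<omega>)) \<in> borel_measurable \<Omega>" "(\<lambda>\<omega>. h (?B \<omega>)) \<in> borel_measurable \<Omega>"
    using measurable_compose[OF W g] measurable_compose[OF B h] by auto
  show ?thesis
    unfolding indep_var_def indep_vars_def2
    by (intro conjI ballI indep_sets_mono_sets[OF ind]) (use rv in \<open>simp_all split: bool.split\<close>)
qed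

lemma expectation_input_entry:
  assumes "m < M" "i < N" "p \<in> {0<..<1}"
  shows "expectation (\<lambda>\<omega>. of_bool (b m i \<omega> \<longleftrightarrow> c)) = (if c then p else 1 - p)"
    and "integrable \<Omega> (\<lambda>\<omega>. of_bool (b m i \<omega> \<longleftrightarrow> c) :: real)"
proof -
  have rv: "b m i \<in> measurable \<Omega> (count_space UNIV)"
    using inputs_indep assms by (auto simp: indep_vars_def)
  have "expectation (\<lambda>\<omega>. of_bool (b m i \<omega> \<longleftrightarrow> c)) =
        (\<integral>x. (of_bool (x \<longleftrightarrow> c) :: real) \<partial>distr \<Omega> (count_space UNIV) (b m i))"
    by (subst integral_distr[OF rv]) auto
  \<comment> \<open>\<open>bernoulli_pmf\<close> clamps its parameter to the unit interval; the
    range of \<open>p\<close> ensures that the probabilities really are \<open>p\<close> and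
    \<open>1 - p\<close>.\<close>
  then show "expectation (\<lambda>\<omega>. of_bool (b m i \<omega> \<longleftrightarrow> c)) = (if c then p else 1 - p)"
    using assms by (simp add: inputs_bernoulli)
  have "(\<lambda>\<omega>. of_bool (b m i \<omega> \<longleftrightarrow> c) :: real) \<in> borel_measurable \<Omega>"
    by (rule measurable_compose[OF rv]) simp
  then show "integrable \<Omega> (\<lambda>\<omega>. of_bool (b m i \<omega> \<longleftrightarrow> c) :: real)"
    by (rule integrable_const_bound[where B = 1, rotated]) auto
qed

text \<open>By independence within row \<open>m\<close>, each entry in \<open>S\<close> contributes
  a factor \<open>p\<close> and each other entry a factor \<open>1 - p\<close>.\<close>

lemma expectation_active_eq:
  assumes m: "m < M" and p: "p \<in> {0<..<1}" and S: "S \<subseteq> {..<N}"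
  shows "expectation (\<lambda>\<omega>. of_bool (active N (\<lambda>i. b m i \<omega>) = S)) =
           p ^ card S * (1 - p) ^ (N - card S)" (is ?exp)
    and "integrable \<Omega> (\<lambda>\<omega>. of_bool (active N (\<lambda>i. b m i \<omega>) = S) :: real)" (is ?int)
proof -
  define X where "X = (\<lambda>(m, i) \<omega>. of_bool (b m i \<omega> \<longleftrightarrow> i \<in> S) :: real)"
  have "indep_vars (\<lambda>_. count_space UNIV) (\<lambda>(m, i). b m i) ({m} \<times> {..<N})"
    using m by (intro indep_vars_subset[OF inputs_indep]) auto
  then have "indep_vars (\<lambda>_. borel)
      (\<lambda>x \<omega>. of_bool ((case x of (m, i) \<Rightarrow> b m i) \<omega> \<longleftrightarrow> snd x \<in> S) :: real) ({m} \<times> {..<N})"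
    by (rule indep_vars_compose2) auto
  then have X: "indep_vars (\<lambda>_. borel) X ({m} \<times> {..<N})"
    by (rule indep_vars_cong[THEN iffD1, rotated -1]) (auto simp: X_def)
  have prod: "(\<Prod>x\<in>{m} \<times> {..<N}. f x) = (\<Prod>i<N. f (m, i))" for f :: "nat \<times> nat \<Rightarrow> real"
  proof -
    have "{m} \<times> {..<N} = Pair m ` {..<N}" by auto
    then show ?thesis by (simp add: prod.reindex inj_on_def)
  qed
  have eq: "of_bool (active N (\<lambda>i. b m i \<omega>) = S) = (\<Prod>x\<in>{m} \<times> {..<N}. X x \<omega>)" for \<omega>
    by (simp add: of_bool_active_eq[OF S] prod X_def)
  have int: "integrable \<Omega> (X x)" if "x \<in> {m} \<times> {..<N}" for x
    using that m p by (auto simp: X_def expectation_input_entry)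
  show ?int
    unfolding eq by (rule indep_vars_integrable[OF _ X int]) auto
  have "expectation (\<lambda>\<omega>. of_bool (active N (\<lambda>i. b m i \<omega>) = S)) =
          (\<Prod>x\<in>{m} \<times> {..<N}. expectation (X x))"
    unfolding eq by (rule indep_vars_lebesgue_integral[OF _ X int]) auto
  also have "\<dots> = (\<Prod>i<N. if i \<in> S then p else 1 - p)"
    using m p by (simp add: prod X_def expectation_input_entry)
  also have "\<dots> = p ^ card S * (1 - p) ^ card ({..<N} - S)"
    using S by (subst prod.If_cases) (auto simp: Int_absorb1 Diff_eq)
  also have "card ({..<N} - S) = N - card S"
    using S by (simp add: card_Diff_subset finite_subset)
  finally show ?exp .
qed

section \<open>Expected gradient by averaging over weights and active sets\<close>

lemma expectation_prod_weights:
  fixes u :: "nat \<Rightarrow> real \<Rightarrow> real"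
  assumes S: "S \<subseteq> {..<N}" and u: "\<And>i. i \<in> S \<Longrightarrow> u i \<in> {\<lambda>x. 1 - 2 * x, \<lambda>x. (1 - 2 * x)\<^sup>2}"
  shows "expectation (\<lambda>\<omega>. \<Prod>i\<in>S. u i (w i \<omega>)) = (\<Prod>i\<in>S. expectation (\<lambda>\<omega>. u i (w i \<omega>)))"
    and "integrable \<Omega> (\<lambda>\<omega>. \<Prod>i\<in>S. u i (w i \<omega>))"
proof -
  have ind: "indep_vars (\<lambda>_. borel) (\<lambda>i \<omega>. u i (w i \<omega>)) S"
    using indep_vars_subset[OF weights_indep S]
  proof (rule indep_vars_compose2)
    show "u i \<in> borel_measurable borel" if "i \<in> S" for i
      using u[OF that] by auto
  qed
  have int: "integrable \<Omega> (\<lambda>\<omega>. u i (w i \<omega>))" if "i \<in> S" for i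
  proof -
    from that S have i: "i < N" by auto
    then have rv: "w i \<in> borel_measurable \<Omega>"
      using weights_indep by (auto simp: indep_vars_def)
    have sq: "integrable \<Omega> (\<lambda>\<omega>. (w i \<omega>)\<^sup>2)" by (rule weights_second_moment[OF i])
    then have lin: "integrable \<Omega> (w i)" by (rule square_integrable_imp_integrable[OF rv])
    have "(\<lambda>\<omega>. (1 - 2 * w i \<omega>)\<^sup>2) = (\<lambda>\<omega>. 1 - 4 * w i \<omega> + 4 * (w i \<omega>)\<^sup>2)"
      by (auto simp: power2_eq_square algebra_simps)
    with u[OF that] sq lin show ?thesis by auto
  qed
  have "finite S" using S finite_subset by blast
  then show "expectation (\<lambda>\<omega>. \<Prod>i\<in>S. u i (w i \<omega>)) = (\<Prod>i\<in>S. expectation (\<lambda>\<omega>. u i (w i \<omega>)))"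
    and "integrable \<Omega> (\<lambda>\<omega>. \<Prod>i\<in>S. u i (w i \<omega>))"
    using indep_vars_lebesgue_integral[OF _ ind int] indep_vars_integrable[OF _ ind int] by auto
qed

lemma expectation_centred_weight:
  assumes "i < N"
  shows "expectation (\<lambda>\<omega>. 1 - 2 * w i \<omega>) = 0"
proof -
  have "w i \<in> borel_measurable \<Omega>"
    using weights_indep assms by (auto simp: indep_vars_def)
  then have "integrable \<Omega> (w i)"
    using weights_second_moment[OF assms] by (rule square_integrable_imp_integrable)
  then show ?thesis by (simp add: weights_mean[OF assms] prob_space)
qed

text \<open>The quadratic term always retains the centred factor of \<open>w j\<close>, so its mean
  vanishes. The linear term omits that factor and vanishes as soon as \<open>S\<close> has an
  element other than \<open>j\<close>.\<close>

lemma expectation_risk_slope: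
  assumes S: "S \<subseteq> {..<N}" and j: "j < N"
  shows "expectation (\<lambda>\<omega>. risk_slope wtrue j S (\<lambda>i. w i \<omega>)) =
           (if S = {j} then 1 - 2 * wtrue j else 0)" (is ?exp)
    and "integrable \<Omega> (\<lambda>\<omega>. risk_slope wtrue j S (\<lambda>i. w i \<omega>))" (is ?int)
proof -
  have "?exp \<and> ?int"
  proof (cases "j \<in> S")
    case False
    then show ?thesis by (auto simp: risk_slope_def)
  next
    case True
    have fin: "finite S" using S finite_subset by blast
    \<comment> \<open>Linear at \<open>j\<close> and squared elsewhere, which writes the quadratic
      term as a single product over \<open>S\<close>.\<close>
    define u :: "nat \<Rightarrow> real \<Rightarrow> real"
      where "u i = (if i = j then (\<lambda>x. 1 - 2 * x) else (\<lambda>x. (1 - 2 * x)\<^sup>2))" for i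
    have slope: "risk_slope wtrue j S (\<lambda>i. w i \<omega>) =
       (\<Prod>i\<in>S. 1 - 2 * wtrue i) * (\<Prod>i\<in>S - {j}. 1 - 2 * w i \<omega>) - (\<Prod>i\<in>S. u i (w i \<omega>))" for \<omega>
      using True fin by (auto simp: risk_slope_def u_def prod.remove[of S j] intro!: prod.cong)
    \<comment> \<open>For \<open>S = {j}\<close> the product is empty, hence 1.\<close>
    have lin: "expectation (\<lambda>\<omega>. \<Prod>i\<in>S - {j}. 1 - 2 * w i \<omega>) = (if S = {j} then 1 else 0)"
    proof (cases "S = {j}")
      case False
      with True obtain k where k: "k \<in> S - {j}" by auto
      have "k < N" using k S by auto
      then have zero: "expectation (\<lambda>\<omega>. 1 - 2 * w k \<omega>) = 0"
        by (rule expectation_centred_weight)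
      have "expectation (\<lambda>\<omega>. \<Prod>i\<in>S - {j}. 1 - 2 * w i \<omega>) =
          (\<Prod>i\<in>S - {j}. expectation (\<lambda>\<omega>. 1 - 2 * w i \<omega>))"
        by (rule expectation_prod_weights(1)[where u = "\<lambda>_ x. 1 - 2 * x"]) (use S in auto)
      also have "\<dots> = 0"
        by (rule prod_zero) (use fin k zero in blast)+
      finally have "expectation (\<lambda>\<omega>. \<Prod>i\<in>S - {j}. 1 - 2 * w i \<omega>) = 0" .
      with False show ?thesis by simp
    qed (simp add: prob_space)
    have lin_int: "integrable \<Omega> (\<lambda>\<omega>. \<Prod>i\<in>S - {j}. 1 - 2 * w i \<omega>)"
      using expectation_prod_weights(2)[of "S - {j}" "\<lambda>_ x. 1 - 2 * x"] S by auto
    have "expectation (\<lambda>\<omega>. u j (w j \<omega>)) = 0"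
      using expectation_centred_weight[OF j] by (simp add: u_def)
    then have quad: "expectation (\<lambda>\<omega>. \<Prod>i\<in>S. u i (w i \<omega>)) = 0"
      using True fin by (subst expectation_prod_weights(1)[OF S]) (auto simp: u_def intro!: prod_zero)
    have quad_int: "integrable \<Omega> (\<lambda>\<omega>. \<Prod>i\<in>S. u i (w i \<omega>))"
      by (rule expectation_prod_weights(2)[OF S]) (auto simp: u_def)
    show ?thesis
      unfolding slope using lin_int quad_int by (simp add: lin quad)
  qed
  then show ?exp ?int by auto
qed

text \<open>Once \<open>S\<close> is fixed, the slope depends on the weights only and the indicator
  on the inputs only, so the expectation factors.\<close>

lemma expectation_active_risk_slope:
  fixes wtrue :: "nat \<Rightarrow> real"
  assumes m: "m < M" and p: "p \<in> {0<..<1}" and S: "S \<subseteq> {..<N}" and j: "j < N"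
  defines "X \<equiv> \<lambda>\<omega>. risk_slope wtrue j S (\<lambda>i. w i \<omega>) * of_bool (active N (\<lambda>i. b m i \<omega>) = S)"
  shows "expectation X = (if S = {j} then (1 - 2 * wtrue j) * (p * (1 - p) ^ (N - 1)) else 0)"
    and "integrable \<Omega> X"
proof -
  define h :: "(nat \<times> nat \<Rightarrow> bool) \<Rightarrow> real" where "h f = (\<Prod>i<N. of_bool (f (m, i) \<longleftrightarrow> i \<in> S))" for f
  have "(\<lambda>f. of_bool (f (m, i) \<longleftrightarrow> i \<in> S) :: real)
          \<in> borel_measurable (PiM ({..<M} \<times> {..<N}) (\<lambda>_. count_space UNIV))" if "i < N" for i
    using that m
    by (intro measurable_compose[OF measurable_component_singleton[of "(m, i)"]]) auto
  then have h: "h \<in> borel_measurable (PiM ({..<M} \<times> {..<N}) (\<lambda>_. count_space UNIV))"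
    unfolding h_def by (intro borel_measurable_prod) auto
  have comp: "(\<lambda>u. u i) \<in> borel_measurable (PiM {..<N} (\<lambda>_. borel :: real measure))"
    if "i < N" for i
    using that by (intro measurable_component_singleton) auto
  have g: "risk_slope wtrue j S \<in> borel_measurable (PiM {..<N} (\<lambda>_. borel))"
  proof (cases "j \<in> S")
    case True
    show ?thesis
      unfolding risk_slope_def if_P[OF True]
      by (intro borel_measurable_diff borel_measurable_times borel_measurable_prod
            borel_measurable_power borel_measurable_const comp) (use S j in auto)
  qed (simp add: risk_slope_def[abs_def])
  \<comment> \<open>Only weights with index in \<open>S\<close> are read, so restricting the weight
    vector to \<open>{..<N}\<close> changes nothing.\<close>
  have gW: "risk_slope wtrue j S (\<lambda>i\<in>{..<N}. w i \<omega>) = risk_slope wtrue j S (\<lambda>i. w i \<omega>)" for \<omega>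
    unfolding risk_slope_def using S j by (auto intro!: arg_cong2[where f = "(-)"]
        arg_cong2[where f = "(*)"] prod.cong)
  have hB: "h (\<lambda>(m, i)\<in>{..<M} \<times> {..<N}. b m i \<omega>) = of_bool (active N (\<lambda>i. b m i \<omega>) = S)" for \<omega>
    unfolding h_def of_bool_active_eq[OF S] using m by (auto intro!: prod.cong)
  note ind = indep_var_weights_inputs[OF g h, unfolded gW hB]
  note ints = expectation_risk_slope(2)[OF S j] expectation_active_eq(2)[OF m p S]
  show "integrable \<Omega> X"
    unfolding X_def by (rule indep_var_integrable[OF ind ints])
  show "expectation X = (if S = {j} then (1 - 2 * wtrue j) * (p * (1 - p) ^ (N - 1)) else 0)"
    unfolding X_def indep_var_lebesgue_integral[OF ind ints]
      expectation_risk_slope(1)[OF S j] expectation_active_eq(1)[OF m p S] by simp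
qed

text \<open>The random active set is removed by a finite sum over its possible values; only the
  summand \<open>S = {j}\<close> has nonzero mean if any has.\<close>

lemma expectation_risk_slope_active:
  fixes wtrue :: "nat \<Rightarrow> real"
  assumes m: "m < M" and p: "p \<in> {0<..<1}" and j: "j < N"
  defines "X \<equiv> \<lambda>\<omega>. risk_slope wtrue j (active N (\<lambda>i. b m i \<omega>)) (\<lambda>i. w i \<omega>)"
  shows "expectation X = (1 - 2 * wtrue j) * (p * (1 - p) ^ (N - 1))"
    and "integrable \<Omega> X"
proof -
  have X: "X = (\<lambda>\<omega>. \<Sum>S\<in>Pow {..<N}.
      risk_slope wtrue j S (\<lambda>i. w i \<omega>) * of_bool (active N (\<lambda>i. b m i \<omega>) = S))"
    (is "X = (\<lambda>\<omega>. \<Sum>S\<in>_. ?Y S \<omega>)")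
  proof
    fix \<omega>
    have "(\<Sum>S\<in>Pow {..<N}. ?Y S \<omega>) = (\<Sum>S\<in>{active N (\<lambda>i. b m i \<omega>)}. ?Y S \<omega>)"
      using active_subset by (intro sum.mono_neutral_right) auto
    then show "X \<omega> = (\<Sum>S\<in>Pow {..<N}. ?Y S \<omega>)" by (simp add: X_def)
  qed
  have int: "integrable \<Omega> (?Y S)" if "S \<in> Pow {..<N}" for S
    using that by (intro expectation_active_risk_slope(2) m p j) simp
  then show "integrable \<Omega> X"
    unfolding X by (rule Bochner_Integration.integrable_sum)
  have "expectation X = (\<Sum>S\<in>Pow {..<N}. expectation (?Y S))"
    unfolding X by (rule Bochner_Integration.integral_sum) (rule int)
  also have "\<dots> = (\<Sum>S\<in>Pow {..<N}.
      if S = {j} then (1 - 2 * wtrue j) * (p * (1 - p) ^ (N - 1)) else 0)"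
    by (intro sum.cong refl expectation_active_risk_slope(1) m p j) simp
  also have "\<dots> = (1 - 2 * wtrue j) * (p * (1 - p) ^ (N - 1))"
    using j by simp
  finally show "expectation X = (1 - 2 * wtrue j) * (p * (1 - p) ^ (N - 1))" .
qed

text \<open>All samples have the same mean slope, so the average over them cancels \<open>M\<close>.
  With \<open>M = 0\<close> the division would give 0 instead.\<close>

lemma expected_gradient_eq:
  assumes M: "M \<ge> 1" and p: "p \<in> {0<..<1}" and j: "j < N"
  shows "expected_gradient \<Omega> N M wtrue w b j = (1 - 2 * wtrue j) * (p * (1 - p) ^ (N - 1))"
proof -
  have "expected_gradient \<Omega> N M wtrue w b j =
        (\<Sum>m<M. expectation (\<lambda>\<omega>. risk_slope wtrue j (active N (\<lambda>i. b m i \<omega>)) (\<lambda>i. w i \<omega>))) / real M"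
    unfolding expected_gradient_def partial_deriv_empirical_risk integral_divide_zero
    by (subst Bochner_Integration.integral_sum)
      (simp_all add: expectation_risk_slope_active(2)[OF _ p j])
  also have "\<dots> = (1 - 2 * wtrue j) * (p * (1 - p) ^ (N - 1))"
    using M by (simp add: expectation_risk_slope_active(1)[OF _ p j])
  finally show ?thesis .
qed

text \<open>The event is the disjoint union over \<open>j\<close> of the events that the active set
  is \<open>{j}\<close>, all of the same probability.\<close>

lemma exactly_one_prob_eq:
  assumes m: "m < M" and p: "p \<in> {0<..<1}"
  shows "exactly_one_prob \<Omega> N (b m) = real N * (p * (1 - p) ^ (N - 1))"
proof -
  have one: "of_bool (card (active N (\<lambda>i. b m i \<omega>)) = 1) =
      (\<Sum>j<N. of_bool (active N (\<lambda>i. b m i \<omega>) = {j}) :: real)" for \<omega>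
  proof (cases "card (active N (\<lambda>i. b m i \<omega>)) = 1")
    case True
    then obtain k where k: "active N (\<lambda>i. b m i \<omega>) = {k}"
      by (auto simp: card_1_singleton_iff)
    then have "k < N" using active_subset[of N "\<lambda>i. b m i \<omega>"] by auto
    with k show ?thesis by (simp add: of_bool_def)
  qed (auto intro!: sum.neutral[symmetric])
  have int: "integrable \<Omega> (\<lambda>\<omega>. of_bool (active N (\<lambda>i. b m i \<omega>) = {j}) :: real)"
    and exp: "expectation (\<lambda>\<omega>. of_bool (active N (\<lambda>i. b m i \<omega>) = {j})) = p * (1 - p) ^ (N - 1)"
    if "j < N" for j
    using expectation_active_eq[OF m p, of "{j}"] that by auto
  have "exactly_one_prob \<Omega> N (b m) =
        measure \<Omega> ({\<omega>. card (active N (\<lambda>i. b m i \<omega>)) = 1} \<inter> space \<Omega>)"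
    unfolding exactly_one_prob_def active_def by (intro arg_cong[where f = "measure \<Omega>"]) auto
  also have "\<dots> = expectation (indicator {\<omega>. card (active N (\<lambda>i. b m i \<omega>)) = 1})"
    by simp
  also have "\<dots> = expectation (\<lambda>\<omega>. \<Sum>j<N. of_bool (active N (\<lambda>i. b m i \<omega>) = {j}))"
    by (intro Bochner_Integration.integral_cong) (simp_all add: one[symmetric] indicator_def)
  also have "\<dots> = real N * (p * (1 - p) ^ (N - 1))"
    by (subst Bochner_Integration.integral_sum) (auto simp: int exp)
  finally show ?thesis .
qed

end

section \<open>Maximising over the sparsity\<close>

text \<open>This is weighted AM-GM in logarithmic form. Strictness comes from equality in
  \<open>ln x \<le> x - 1\<close> holding only at 1.\<close>

lemma one_active_weight_less:
  fixes q :: real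
  assumes N: "N \<ge> 2" and q: "q \<in> {0<..<1}" and ne: "q \<noteq> 1 / real N"
  shows "q * (1 - q) ^ (N - 1) < 1 / real N * (1 - 1 / real N) ^ (N - 1)"
proof -
  define n where "n = real N - 1"
  have n: "n > 0" "real N = n + 1" "real (N - 1) = n" using N by (auto simp: n_def)
  \<comment> \<open>\<open>x\<close> and \<open>y\<close> are \<open>q\<close> and
    \<open>1 - q\<close> relative to their values at \<open>1 / real N\<close>, so
    \<open>x * y ^ (N - 1)\<close> is the quotient of the two sides.\<close>
  define x where "x = real N * q"
  define y where "y = (1 - q) * real N / n"
  have pos: "x > 0" "y > 0" using q n N by (auto simp: x_def y_def)
  have "x \<noteq> 1" using ne N by (auto simp: x_def field_simps)
  then have "ln x < x - 1" using ln_le_minus_one[OF pos(1)] ln_eq_minus_one[OF pos(1)] by linarith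
  moreover have "n * ln y \<le> n * (y - 1)"
    using ln_le_minus_one[OF pos(2)] n by (intro mult_left_mono) auto
  \<comment> \<open>The normalisation makes the two linear bounds cancel, because \<open>q\<close>
    and \<open>1 - q\<close> add up to 1.\<close>
  moreover have "x - 1 + n * (y - 1) = 0"
    using n(1) by (simp add: x_def y_def n(2) field_simps)
  ultimately have "ln x + n * ln y < 0" by linarith
  then have "ln (x * y ^ (N - 1)) < 0"
    using pos n by (simp add: ln_mult ln_realpow)
  then have "x * y ^ (N - 1) < 1" using pos by simp
  moreover have "q * (1 - q) ^ (N - 1) =
      x * y ^ (N - 1) * (1 / real N * (1 - 1 / real N) ^ (N - 1))"
  proof -
    have "1 - 1 / real N = n / real N" using n by (simp add: field_simps)
    then have "1 - q = y * (1 - 1 / real N)" using n(1) N by (simp add: y_def)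
    then have "(1 - q) ^ (N - 1) = y ^ (N - 1) * (1 - 1 / real N) ^ (N - 1)"
      by (simp add: power_mult_distrib)
    moreover have "q = x * (1 / real N)" using N by (simp add: x_def)
    ultimately show ?thesis by (simp add: mult_ac)
  qed
  moreover have "1 / real N * (1 - 1 / real N) ^ (N - 1) > 0" using N by simp
  ultimately show ?thesis using mult_strict_right_mono by fastforce
qed

text \<open>Serves both the gradient magnitude (\<open>c = 1\<close>) and the probability of one
  active entry (\<open>c = real N\<close>). Strict inequality away from \<open>1 / real N\<close>
  makes the maximiser unique.\<close>

lemma is_arg_max_one_active_weight:
  fixes c :: real
  assumes N: "N \<ge> 2" and c: "c > 0"
    and F: "\<And>q. q \<in> {0<..<1} \<Longrightarrow> F q = c * (q * (1 - q) ^ (N - 1))"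
  shows "is_arg_max F (\<lambda>q. q \<in> {0<..<1}) p \<longleftrightarrow> p = 1 / real N"
proof -
  have N1: "1 / real N \<in> {0<..<1}" using N by auto
  have less: "F q < F (1 / real N)" if "q \<in> {0<..<1}" "q \<noteq> 1 / real N" for q
    unfolding F[OF that(1)] F[OF N1]
    by (rule mult_strict_left_mono[OF one_active_weight_less[OF N that] c])
  show ?thesis
    unfolding is_arg_max_def using less N1 by (metis less_asym)
qed

text \<open>Each sparsity has its own probability space, since the law of the inputs depends on it.
  The coincidence in (iii) is expressed by two maximisation problems having the same unique
  solution.\<close>

theorem propositionF2:
  fixes N M :: nat
    and wtrue :: "nat \<Rightarrow> real"
    and D :: "real measure"
    and \<Omega> :: "real \<Rightarrow> 'a measure"
    and w :: "real \<Rightarrow> nat \<Rightarrow> 'a \<Rightarrow> real"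
    and b :: "real \<Rightarrow> nat \<Rightarrow> nat \<Rightarrow> 'a \<Rightarrow> bool"
    and G :: "nat \<Rightarrow> real \<Rightarrow> real"
  assumes N: "N \<ge> 2"
    and M: "M \<ge> 1"
    and wtrue: "\<And>i. i < N \<Longrightarrow> wtrue i \<in> {0, 1}"
    and model: "\<And>p. p \<in> {0<..<1} \<Longrightarrow> xor_training (\<Omega> p) N M p D (w p) (b p)"
    and G: "\<And>j p. G j p = expected_gradient (\<Omega> p) N M wtrue (w p) (b p) j"
  shows
    "(\<forall>j<N. \<forall>p\<in>{0<..<1}.
        (wtrue j = 1 \<longrightarrow> G j p < 0) \<and>
        (wtrue j = 0 \<longrightarrow> G j p > 0) \<and>
        (\<forall>\<alpha>>0. \<forall>x\<in>{0<..<1}. sgn ((x - \<alpha> * G j p) - x) = sgn (wtrue j - x))) \<and>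
     (\<forall>j<N. \<forall>p. is_arg_max (\<lambda>q. \<bar>G j q\<bar>) (\<lambda>q. q \<in> {0<..<1}) p \<longleftrightarrow> p = 1 / real N) \<and>
     (\<forall>m<M. \<forall>p. is_arg_max (\<lambda>q. exactly_one_prob (\<Omega> q) N (b q m)) (\<lambda>q. q \<in> {0<..<1}) p
        \<longleftrightarrow> p = 1 / real N)"
proof (intro conjI)
  have G_eq: "G j p = (1 - 2 * wtrue j) * (p * (1 - p) ^ (N - 1))"
    if "j < N" "p \<in> {0<..<1}" for j p
    unfolding G by (rule xor_training.expected_gradient_eq[OF model[OF that(2)] M that(2,1)])
  have pos: "p * (1 - p) ^ (N - 1) > 0" if "p \<in> {0<..<1}" for p :: real
    using that by simp
  show "\<forall>j<N. \<forall>p\<in>{0<..<1}.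
        (wtrue j = 1 \<longrightarrow> G j p < 0) \<and>
        (wtrue j = 0 \<longrightarrow> G j p > 0) \<and>
        (\<forall>\<alpha>>0. \<forall>x\<in>{0<..<1}. sgn ((x - \<alpha> * G j p) - x) = sgn (wtrue j - x))"
  proof (intro allI impI ballI)
    fix j p assume j: "j < N" and p: "p \<in> {0<..<1::real}"
    from wtrue[OF j] consider "wtrue j = 0" "G j p > 0" | "wtrue j = 1" "G j p < 0"
      using pos[OF p] by (auto simp: G_eq[OF j p])
    \<comment> \<open>For \<open>x\<close> strictly between 0 and 1 the sign of
      \<open>wtrue j - x\<close> depends only on \<open>wtrue j\<close>, and the update has the sign
      of \<open>- G j p\<close>.\<close>
    then show "(wtrue j = 1 \<longrightarrow> G j p < 0) \<and> (wtrue j = 0 \<longrightarrow> G j p > 0) \<and>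
        (\<forall>\<alpha>>0. \<forall>x\<in>{0<..<1}. sgn ((x - \<alpha> * G j p) - x) = sgn (wtrue j - x))"
      by cases (auto simp: sgn_if mult_less_0_iff zero_less_mult_iff)
  qed
  show "\<forall>j<N. \<forall>p. is_arg_max (\<lambda>q. \<bar>G j q\<bar>) (\<lambda>q. q \<in> {0<..<1}) p \<longleftrightarrow> p = 1 / real N"
  proof (intro allI impI)
    fix j p assume j: "j < N"
    have "\<bar>G j q\<bar> = 1 * (q * (1 - q) ^ (N - 1))" if "q \<in> {0<..<1}" for q
    proof -
      \<comment> \<open>A binary oracle weight affects only the sign of the gradient, so its
        magnitude is the same for every \<open>j\<close>.\<close>
      have "\<bar>1 - 2 * wtrue j\<bar> = 1" using wtrue[OF j] by auto
      then show ?thesis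
        by (simp only: G_eq[OF j that] abs_mult[of "1 - 2 * wtrue j"] abs_of_pos[OF pos[OF that]])
    qed
    then show "is_arg_max (\<lambda>q. \<bar>G j q\<bar>) (\<lambda>q. q \<in> {0<..<1}) p \<longleftrightarrow> p = 1 / real N"
      by (intro is_arg_max_one_active_weight[OF N, where c = 1]) auto
  qed
  show "\<forall>m<M. \<forall>p. is_arg_max (\<lambda>q. exactly_one_prob (\<Omega> q) N (b q m)) (\<lambda>q. q \<in> {0<..<1}) p
        \<longleftrightarrow> p = 1 / real N"
  proof (intro allI impI)
    fix m p assume m: "m < M"
    show "is_arg_max (\<lambda>q. exactly_one_prob (\<Omega> q) N (b q m)) (\<lambda>q. q \<in> {0<..<1}) p
        \<longleftrightarrow> p = 1 / real N"
      using N xor_training.exactly_one_prob_eq[OF model m]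
      by (intro is_arg_max_one_active_weight[OF N, where c = "real N"]) auto
  qed
qed

end
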